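(* Let $n\ge 2$ be an integer, let $\lambda\in(0,1/n)$, and let $E_\lambda^n$ be the homogeneous self-similar set defined in the context. The following statements are equivalent: (1) $L_{AP}(E_\lambda^n)\ge n+1$; (2) $\lambda\ge \frac{1}{2n-1}$; (3) $L_{AP}(E_\lambda^n)\ge 2n$. In particular, $L_{AP}(E_\lambda^n)=n$ if and only if $\lambda\in\left(0,\frac{1}{2n-1}\right)$.
   Context: An arithmetic progression (A.P.) of length $k\in\mathbb{N}^+$ in $\mathbb{R}$ is a set $\{a,a+\delta,a+2\delta,\dots,a+(k-1)\delta\}$ with $a\in\mathbb{R}$ and $\delta>0$ (the common difference). For $F\subset\mathbb{R}$, $L_{AP}(F)=\sup\{k:\ F \text{ contains an A.P. of length } k\}$. For an integer $n\ge 2$ and $\lambda\in(0,1/n)$, put $\alpha=\frac{1-n\lambda}{n-1}$ and $b_i=(i-1)(\lambda+\alpha)$ for $i=1,\dots,n$ (so $b_1=0$ and $b_n=1-\lambda$). The set $E_\lambda^n$ is the self-similar set (attractor) of the iterated function system $\{f_i(x)=\lambda x+b_i\}_{i=1}^n$, i.e. the unique nonempty compact set $E\subset\mathbb{R}$ with $E=\bigcup_{i=1}^n(\lambda E+b_i)$. *)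

theory Defs
  imports "HOL-Analysis.Analysis"
begin

definition is_AP :: "nat \<Rightarrow> real set \<Rightarrow> bool" where
  "is_AP k A \<longleftrightarrow> k \<ge> 1 \<and> (\<exists>a \<delta>. \<delta> > 0 \<and> A = {a + real j * \<delta> | j. j < k})"

text \<open>The supremum is taken in \<^typ>\<open>enat\<close>, since \<open>F\<close> may contain arbitrarily long progressions;
  it is \<open>0\<close> only for \<open>F = {}\<close>.\<close>

definition L_AP :: "real set \<Rightarrow> enat" where
  "L_AP F = (SUP k \<in> {k. \<exists>A. is_AP k A \<and> A \<subseteq> F}. enat k)"

definition is_attractor :: "'i set \<Rightarrow> ('i \<Rightarrow> real \<Rightarrow> real) \<Rightarrow> real set \<Rightarrow> bool" where
  "is_attractor I f E \<longleftrightarrow> E \<noteq> {} \<and> compact E \<and> E = (\<Union>i\<in>I. f i ` E)"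

definition attractor :: "'i set \<Rightarrow> ('i \<Rightarrow> real \<Rightarrow> real) \<Rightarrow> real set" where
  "attractor I f = (THE E. is_attractor I f E)"

definition gap :: "nat \<Rightarrow> real \<Rightarrow> real" where
  "gap n l = (1 - real n * l) / (real n - 1)"

definition shift :: "nat \<Rightarrow> real \<Rightarrow> nat \<Rightarrow> real" where
  "shift n l i = (real i - 1) * (l + gap n l)"

definition homog_ifs :: "nat \<Rightarrow> real \<Rightarrow> nat \<Rightarrow> real \<Rightarrow> real" where
  "homog_ifs n l i x = l * x + shift n l i"

definition homog_set :: "nat \<Rightarrow> real \<Rightarrow> real set" where
  "homog_set n l = attractor {1..n} (homog_ifs n l)"

text \<open>Well-definedness: the description in \<^const>\<open>attractor\<close> is proper for the systems at hand.\<close>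

lemma is_attractor_subset:
  fixes b :: "'i \<Rightarrow> real"
  assumes l: "0 < l" "l < 1"
    and E: "is_attractor I (\<lambda>i x. l * x + b i) E"
    and F: "is_attractor I (\<lambda>i x. l * x + b i) F"
  shows "E \<subseteq> F"
proof -
  have cE: "compact E" "E \<noteq> {}" "E = (\<Union>i\<in>I. (\<lambda>x. l * x + b i) ` E)"
    using E unfolding is_attractor_def by blast+
  have cF: "compact F" "F \<noteq> {}" "F = (\<Union>i\<in>I. (\<lambda>x. l * x + b i) ` F)"
    using F unfolding is_attractor_def by blast+
  have "continuous_on E (\<lambda>x. infdist x F)" by (intro continuous_intros)
  then obtain x where x: "x \<in> E" and mx: "\<And>y. y \<in> E \<Longrightarrow> infdist y F \<le> infdist x F"
    using continuous_attains_sup[OF cE(1,2)] by blast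
  obtain i y where iy: "i \<in> I" "y \<in> E" "x = l * y + b i" using x cE(3) by blast
  obtain z where z: "z \<in> F" "infdist y F = dist y z"
    using infdist_attains_inf[OF compact_imp_closed[OF cF(1)] cF(2)] by metis
  have "l * z + b i \<in> F" using cF(3) iy(1) z(1) by blast
  then have "infdist x F \<le> dist x (l * z + b i)" by (rule infdist_le)
  also have "\<dots> = l * dist y z"
    using l iy(3) by (simp add: dist_real_def abs_mult flip: right_diff_distrib)
  also have "\<dots> \<le> l * infdist x F" using z(2) mx[OF iy(2)] l by simp
  finally have "(1 - l) * infdist x F \<le> 0" by (simp add: algebra_simps)
  then have "infdist x F \<le> 0" using l by (simp add: mult_le_0_iff)
  then have "infdist y F = 0" if "y \<in> E" for y
    using mx[OF that] infdist_nonneg[of y F] by linarith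
  then show ?thesis
    using in_closed_iff_infdist_zero[OF compact_imp_closed[OF cF(1)] cF(2)] by blast
qed

lemma shift_bounds:
  assumes "2 \<le> n" "0 < l" "l < 1 / real n" "i \<in> {1..n}"
  shows "0 \<le> shift n l i" "shift n l i \<le> 1 - l"
proof -
  have n: "real n \<ge> 2" using assms by simp
  have "real n * l < 1" using assms n by (simp add: field_simps)
  moreover have e: "l + gap n l = (1 - l) / (real n - 1)"
    using n unfolding gap_def by (simp add: field_simps)
  moreover have "l < 1"
  proof -
    have "l * 1 \<le> l * real n" using n assms by (intro mult_left_mono) auto
    then show ?thesis using calculation(1) by (simp add: mult.commute)
  qed
  ultimately have p: "(1 - l) / (real n - 1) \<ge> 0" using n by simp
  have i: "0 \<le> real i - 1" "real i - 1 \<le> real n - 1" using assms by auto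
  show "0 \<le> shift n l i" unfolding shift_def e by (rule mult_nonneg_nonneg[OF i(1) p])
  have "shift n l i \<le> (real n - 1) * ((1 - l) / (real n - 1))"
    unfolding shift_def e using p i by (intro mult_right_mono) auto
  then show "shift n l i \<le> 1 - l" using n by simp
qed

lemma is_attractor_exists:
  assumes "2 \<le> n" "0 < l" "l < 1 / real n"
  shows "\<exists>E. is_attractor {1..n} (homog_ifs n l) E"
proof -
  define T where "T = (\<lambda>S. \<Union>i\<in>{1..n}. homog_ifs n l i ` S)"
  define K where "K = (\<lambda>k. (T ^^ k) {0..1})"
  have Ksuc: "K (Suc k) = T (K k)" for k by (simp add: K_def)
  have mono: "T A \<subseteq> T B" if "A \<subseteq> B" for A B using that unfolding T_def by blast
  have comp: "compact (K k)" for k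
  proof (induction k)
    case (Suc k)
    have "compact (homog_ifs n l i ` K k)" for i
      unfolding homog_ifs_def by (intro compact_continuous_image continuous_intros Suc)
    then show ?case unfolding Ksuc T_def by (intro compact_UN) auto
  qed (simp add: K_def)
  have ne: "K k \<noteq> {}" for k
  proof (induction k)
    case (Suc k)
    then show ?case unfolding Ksuc T_def using assms(1) by auto
  qed (simp add: K_def)
  have dec: "K (Suc k) \<subseteq> K k" for k
  proof (induction k)
    case 0
    have "homog_ifs n l i x \<in> {0..1}" if "i \<in> {1..n}" "x \<in> {0..1}" for i x
    proof -
      have "0 \<le> l * x" "l * x \<le> l * 1" using that assms by (auto intro: mult_left_mono)
      then show ?thesis using shift_bounds[OF assms that(1)] unfolding homog_ifs_def by simp
    qed
    then show ?case unfolding Ksuc T_def by (auto simp: K_def)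
  next
    case (Suc k)
    then show ?case unfolding Ksuc[of k] Ksuc[of "Suc k"] by (intro mono)
  qed
  have decs: "K m \<subseteq> K k" if "k \<le> m" for k m
    using that by (rule lift_Suc_antimono_le[of K, OF dec])
  define E where "E = (\<Inter>k. K k)"
  have "E \<noteq> {}" unfolding E_def using compact_nest[of K] comp ne decs by blast
  moreover have "compact E" unfolding E_def
    by (intro compact_Inter) (use comp in auto)
  moreover have "T E \<subseteq> E"
  proof -
    have "T E \<subseteq> K (Suc k)" for k unfolding Ksuc by (intro mono) (auto simp: E_def)
    then have "T E \<subseteq> K k" for k using dec by blast
    then show ?thesis unfolding E_def by blast
  qed
  moreover have "E \<subseteq> T E"
  proof
    fix x assume x: "x \<in> E"
    define g where "g = (\<lambda>i. (x - shift n l i) / l)"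
    have inv: "homog_ifs n l i (g i) = x" for i
      using assms(2) by (simp add: g_def homog_ifs_def)
    have inj: "y = g i" if "homog_ifs n l i y = x" for i y
      using assms(2) that by (auto simp: g_def homog_ifs_def)
    show "x \<in> T E"
    proof (rule ccontr)
      assume "x \<notin> T E"
      then have "\<forall>i\<in>{1..n}. \<exists>k. g i \<notin> K k"
        unfolding T_def E_def using inv by (metis (no_types, lifting) INT_I UN_I image_eqI)
      then obtain k where k: "\<And>i. i \<in> {1..n} \<Longrightarrow> g i \<notin> K (k i)" by metis
      define m where "m = Max (k ` {1..n})"
      have "k i \<le> m" if "i \<in> {1..n}" for i unfolding m_def using that by auto
      then have "g i \<notin> K m" if "i \<in> {1..n}" for i using decs k that by blast
      moreover have "x \<in> T (K m)" using x unfolding E_def Ksuc[symmetric] by blast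
      ultimately show False unfolding T_def using inj by blast
    qed
  qed
  ultimately have "is_attractor {1..n} (homog_ifs n l) E"
    unfolding is_attractor_def T_def by blast
  then show ?thesis ..
qed

theorem is_attractor_homog_set:
  assumes "2 \<le> n" "0 < l" "l < 1 / real n"
  shows "is_attractor {1..n} (homog_ifs n l) (homog_set n l)"
    and "is_attractor {1..n} (homog_ifs n l) E \<Longrightarrow> E = homog_set n l"
proof -
  have "1 / real n \<le> 1" using assms(1) by simp
  then have l1: "l < 1" using assms(3) by linarith
  have u: "A = B" if "is_attractor {1..n} (homog_ifs n l) A"
    "is_attractor {1..n} (homog_ifs n l) B" for A B
    using is_attractor_subset[OF assms(2) l1, of "{1..n}" "shift n l"] that
    unfolding homog_ifs_def[abs_def] by blast
  have "\<exists>!E. is_attractor {1..n} (homog_ifs n l) E"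
    using is_attractor_exists[OF assms] u by blast
  then show *: "is_attractor {1..n} (homog_ifs n l) (homog_set n l)"
    unfolding homog_set_def attractor_def by (rule theI')
  show "is_attractor {1..n} (homog_ifs n l) E \<Longrightarrow> E = homog_set n l" using u * by blast
qed

end

theory Submission
  imports Defs
begin

text \<open>
  Write \<open>E = homog_set n l\<close>, and \<open>D = l + gap n l\<close> for the distance between the left ends of
  neighbouring first-level pieces, so that \<open>(n - 1) D = 1 - l\<close> and \<open>E = (l E) \<union> (l E + D) \<union> \<dots> \<union> (l E + (n - 1) D)\<close> with
  \<open>E \<subseteq> [0,1]\<close>. Taking the copies of one point in the \<open>n\<close> pieces always gives a progression of length
  \<open>n\<close>. The threshold \<open>l \<ge> 1 / (2 n - 1)\<close> says that \<open>D \<le> 2 l\<close>, that is, a gap is at most as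
  long as a piece.

  Below the threshold (\<open>no_longer_AP\<close>), a gap is longer than a piece. Among \<open>n + 1\<close> terms two lie in
  the same piece, so the common difference is at most \<open>l\<close>, hence smaller than a gap; therefore all
  terms lie in a single piece. Rescaling that piece gives a progression of the same length in \<open>E\<close>
  whose difference is \<open>1 / l\<close> times as large. Repeating this, the difference outgrows the
  diameter of \<open>E\<close>.

  At the threshold and above it (\<open>AP_length_double\<close>), the aim is a progression with difference
  \<open>D / 2\<close> and two terms in each piece. Because the pieces are translates of each other by multiples of \<open>D\<close>, it suffices
  to find two points of \<open>l E\<close> at distance \<open>D / 2\<close>, that is, two points of \<open>E\<close> at distance
  \<open>D / (2 l) \<le> 1\<close>. They exist because \<open>E - E\<close> is all of \<open>[-1,1]\<close> (\<open>differences_cover\<close>): it is the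
  attractor of the maps \<open>t \<mapsto> l t + k D\<close> with \<open>\<bar>k\<bar> \<le> n - 1\<close>, and the images of \<open>[-1,1]\<close> under
  these maps cover \<open>[-1,1]\<close> exactly when \<open>D \<le> 2 l\<close>.
\<close>

lemma L_AP_ge_iff:
  assumes "k \<ge> 1"
  shows "enat k \<le> L_AP F \<longleftrightarrow> (\<exists>a \<delta>. \<delta> > 0 \<and> (\<forall>j<k. a + real j * \<delta> \<in> F))"
proof
  assume "enat k \<le> L_AP F"
  then have "enat (k - 1) < L_AP F"
    using assms by (metis diff_less enat_ord_simps(2) less_le_trans less_one not_le zero_less_one)
  then obtain m A where m: "is_AP m A" "A \<subseteq> F" "k - 1 < m"
    unfolding L_AP_def less_SUP_iff by auto
  then obtain a \<delta> where "\<delta> > 0" "A = {a + real j * \<delta> | j. j < m}"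
    unfolding is_AP_def by blast
  with m show "\<exists>a \<delta>. \<delta> > 0 \<and> (\<forall>j<k. a + real j * \<delta> \<in> F)"
    by (intro exI[of _ a] exI[of _ \<delta>]) fastforce
next
  assume "\<exists>a \<delta>. \<delta> > 0 \<and> (\<forall>j<k. a + real j * \<delta> \<in> F)"
  then obtain a \<delta> where "\<delta> > 0" "\<forall>j<k. a + real j * \<delta> \<in> F" by blast
  then have "is_AP k {a + real j * \<delta> | j. j < k}" "{a + real j * \<delta> | j. j < k} \<subseteq> F"
    using assms unfolding is_AP_def by blast+
  then show "enat k \<le> L_AP F"
    unfolding L_AP_def by (intro SUP_upper) blast
qed

locale homogeneous_system =
  fixes n :: nat and l :: real
  assumes n2: "2 \<le> n" and l_pos: "0 < l" and l_less: "l < 1 / real n"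
begin

definition D :: real where "D = l + gap n l"

abbreviation E :: "real set" where "E \<equiv> homog_set n l"

lemma l_less_1: "l < 1"
proof -
  have "1 / real n \<le> 1" using n2 by simp
  then show ?thesis using l_less by linarith
qed

lemma D_mult: "(real n - 1) * D = 1 - l"
  using n2 unfolding D_def gap_def by (simp add: field_simps)

lemma D_pos: "0 < D"
proof -
  have "0 < (real n - 1) * D" using D_mult l_less_1 by simp
  then show ?thesis using n2 by (simp add: zero_less_mult_iff)
qed

lemma threshold_iff: "1 / (2 * real n - 1) \<le> l \<longleftrightarrow> D \<le> 2 * l"
proof -
  have n: "real n - 1 > 0" using n2 by simp
  have "D \<le> 2 * l \<longleftrightarrow> (real n - 1) * D \<le> (real n - 1) * (2 * l)" using n by simp
  also have "\<dots> \<longleftrightarrow> 1 \<le> l * (2 * real n - 1)" unfolding D_mult by (simp add: algebra_simps)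
  also have "\<dots> \<longleftrightarrow> 1 / (2 * real n - 1) \<le> l" using n by (simp add: field_simps)
  finally show ?thesis by simp
qed

lemma E_attractor: "is_attractor {1..n} (homog_ifs n l) E"
  by (rule is_attractor_homog_set(1)[OF n2 l_pos l_less])

lemma E_compact: "compact E" and E_nonempty: "E \<noteq> {}"
  using E_attractor unfolding is_attractor_def by blast+

lemma E_iff: "x \<in> E \<longleftrightarrow> (\<exists>i<n. \<exists>y\<in>E. x = l * y + real i * D)"
proof -
  have E: "E = (\<Union>i\<in>{1..n}. homog_ifs n l i ` E)"
    using E_attractor unfolding is_attractor_def by blast
  have "{1..n} = Suc ` {..<n}" by (simp add: image_Suc_lessThan)
  moreover have "homog_ifs n l (Suc i) y = l * y + real i * D" for i y
    unfolding homog_ifs_def shift_def D_def by simp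
  ultimately have "(\<Union>i\<in>{1..n}. homog_ifs n l i ` E) = (\<Union>i<n. (\<lambda>y. l * y + real i * D) ` E)"
    by simp
  with E have "E = (\<Union>i<n. (\<lambda>y. l * y + real i * D) ` E)" by simp
  then show ?thesis by blast
qed

text \<open>
  The largest point \<open>s\<close> lies in some piece, so \<open>s \<le> l s + (1 - l)\<close>; likewise the smallest point
  \<open>r\<close> satisfies \<open>r \<ge> l r\<close>.
\<close>

lemma E_bounds: "x \<in> E \<Longrightarrow> 0 \<le> x \<and> x \<le> 1"
proof -
  assume x: "x \<in> E"
  obtain s where s: "s \<in> E" "\<And>y. y \<in> E \<Longrightarrow> y \<le> s"
    using compact_attains_sup[OF E_compact E_nonempty] by blast
  obtain i y where i: "i < n" "y \<in> E" "s = l * y + real i * D" using s(1) E_iff by blast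
  have "real i * D \<le> (real n - 1) * D" using i(1) D_pos by (intro mult_right_mono) auto
  moreover have "l * y \<le> l * s" using s(2)[OF i(2)] l_pos by simp
  ultimately have "(1 - l) * s \<le> (1 - l) * 1" using i(3) D_mult by (simp add: algebra_simps)
  then have "s \<le> 1" using l_less_1 by simp
  obtain r where r: "r \<in> E" "\<And>y. y \<in> E \<Longrightarrow> r \<le> y"
    using compact_attains_inf[OF E_compact E_nonempty] by blast
  obtain j z where j: "j < n" "z \<in> E" "r = l * z + real j * D" using r(1) E_iff by blast
  have "l * r \<le> l * z" using r(2)[OF j(2)] l_pos by simp
  moreover have "0 \<le> real j * D" using D_pos by simp
  ultimately have "0 \<le> (1 - l) * r" using j(3) by (simp add: algebra_simps)
  then have "0 \<le> r" using l_less_1 by (simp add: zero_le_mult_iff)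
  with \<open>s \<le> 1\<close> show ?thesis using s(2)[OF x] r(2)[OF x] by linarith
qed

lemma E_diff_le: "x \<in> E \<Longrightarrow> y \<in> E \<Longrightarrow> x - y \<le> 1"
  using E_bounds[of x] E_bounds[of y] by linarith

section \<open>Progressions when gaps are longer than pieces\<close>

text \<open>
  Two of the \<open>n + 1\<close> terms share a piece, which bounds \<open>\<delta>\<close> by \<open>l\<close>; a step of at most \<open>l\<close> cannot
  cross a gap, so the whole progression lies in one piece and can be rescaled.
\<close>

lemma AP_rescale:
  assumes small: "2 * l < D" and \<delta>: "0 < \<delta>"
    and ap: "\<And>j. j \<le> n \<Longrightarrow> a + real j * \<delta> \<in> E"
  shows "\<exists>a'. \<forall>j\<le>n. a' + real j * (\<delta> / l) \<in> E"
proof -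
  have "\<forall>j\<in>{..n}. \<exists>i y. i < n \<and> y \<in> E \<and> a + real j * \<delta> = l * y + real i * D"
    using ap E_iff by (metis atMost_iff)
  then obtain p y where p: "\<And>j. j \<le> n \<Longrightarrow> p j < n"
    and y: "\<And>j. j \<le> n \<Longrightarrow> y j \<in> E"
    and eq: "\<And>j. j \<le> n \<Longrightarrow> a + real j * \<delta> = l * y j + real (p j) * D"
    by (metis atMost_iff)
  have "p ` {..n} \<subseteq> {..<n}" using p by auto
  then have "card (p ` {..n}) \<le> n" using card_mono[of "{..<n}"] by simp
  then have "\<not> inj_on p {..n}" by (intro pigeonhole) simp
  then obtain i j where ij: "i < j" "j \<le> n" "p i = p j"
    unfolding inj_on_def by (metis atMost_iff nat_neq_iff)
  have "1 * \<delta> \<le> (real j - real i) * \<delta>" using ij(1) \<delta> by (intro mult_right_mono) auto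
  also have "\<dots> = l * (y j - y i)" using eq[of i] eq[of j] ij by (simp add: algebra_simps)
  also have "\<dots> \<le> l" using E_diff_le[OF y y, of j i] ij l_pos by simp
  finally have \<delta>_le: "\<delta> \<le> l" by simp
  have step: "p (Suc k) = p k" if k: "Suc k \<le> n" for k
  proof -
    have e: "\<delta> = l * (y (Suc k) - y k) + (real (p (Suc k)) - real (p k)) * D"
      using eq[of k] eq[OF k] k by (simp add: algebra_simps)
    have u: "l * (y (Suc k) - y k) \<le> l" using E_diff_le[OF y y, of "Suc k" k] k l_pos by simp
    have "l * (y k - y (Suc k)) \<le> l" using E_diff_le[OF y y, of k "Suc k"] k l_pos by simp
    then have v: "- l \<le> l * (y (Suc k) - y k)" by (simp add: algebra_simps)
    have "\<not> p k < p (Suc k)"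
    proof
      assume "p k < p (Suc k)"
      then have "1 * D \<le> (real (p (Suc k)) - real (p k)) * D"
        using D_pos by (intro mult_right_mono) auto
      then show False using e v small \<delta>_le by linarith
    qed
    moreover have "\<not> p (Suc k) < p k"
    proof
      assume "p (Suc k) < p k"
      then have "(real (p (Suc k)) - real (p k)) * D \<le> (-1) * D"
        using D_pos by (intro mult_right_mono) auto
      then show False using e u small l_pos \<delta> by linarith
    qed
    ultimately show ?thesis by linarith
  qed
  have const: "p k = p 0" if "k \<le> n" for k
    using that by (induction k) (auto simp: step)
  have "y j = y 0 + real j * (\<delta> / l)" if "j \<le> n" for j
    using eq[OF that] eq[of 0] const[OF that] l_pos by (simp add: field_simps)
  then have "\<forall>j\<le>n. y 0 + real j * (\<delta> / l) \<in> E" using y by metis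
  then show ?thesis ..
qed

text \<open>
  Each rescaling divides the difference by \<open>l < 1\<close>, but two points of \<open>E\<close> are at distance at most
  \<open>1\<close>.
\<close>

lemma no_longer_AP:
  assumes small: "2 * l < D" and \<delta>: "0 < \<delta>"
    and ap: "\<And>j. j \<le> n \<Longrightarrow> a + real j * \<delta> \<in> E"
  shows False
proof -
  have iter: "\<exists>a. \<forall>j\<le>n. a + real j * (\<delta> / l ^ m) \<in> E" for m
  proof (induction m)
    case 0
    then show ?case using ap by auto
  next
    case (Suc m)
    then obtain b where "\<And>j. j \<le> n \<Longrightarrow> b + real j * (\<delta> / l ^ m) \<in> E" by blast
    then have "\<exists>a'. \<forall>j\<le>n. a' + real j * (\<delta> / l ^ m / l) \<in> E"
      using \<delta> l_pos by (intro AP_rescale[OF small]) auto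
    then show ?case by (simp add: mult.commute)
  qed
  obtain m where m: "l ^ m < \<delta>" using real_arch_pow_inv[OF \<delta> l_less_1] by blast
  obtain b where b: "\<And>j. j \<le> n \<Longrightarrow> b + real j * (\<delta> / l ^ m) \<in> E" using iter[of m] by blast
  have "\<delta> / l ^ m \<le> 1" using E_diff_le[OF b[of 1] b[of 0]] n2 by simp
  then show False using m l_pos by (simp add: field_simps)
qed

section \<open>Progressions when gaps are at most as long as pieces\<close>

text \<open>
  The intervals \<open>[k D - l, k D + l]\<close> with \<open>\<bar>k\<bar> \<le> n - 1\<close> run from \<open>-1\<close> to \<open>1\<close>, and neighbouring
  ones meet because their centres are at distance \<open>D \<le> 2 l\<close>. The integer \<open>k\<close> is written as \<open>i - j\<close>
  because the map \<open>t \<mapsto> l t + k D\<close> on differences comes from applying \<open>x \<mapsto> l x + i D\<close> to one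
  point and \<open>x \<mapsto> l x + j D\<close> to the other.
\<close>

lemma difference_intervals_cover:
  assumes large: "D \<le> 2 * l" and t: "t \<in> {-1..1}"
  shows "\<exists>i j s. i < n \<and> j < n \<and> s \<in> {-1..1} \<and> t = l * s + (real i - real j) * D"
proof -
  have "\<exists>k::int. \<bar>k\<bar> < int n \<and> \<bar>t - of_int k * D\<bar> \<le> l"
  proof -
    consider "1 - l \<le> t" | "t \<le> l - 1" | "\<bar>t\<bar> < 1 - l" by linarith
    then show ?thesis
    proof cases
      case 1
      then show ?thesis using t n2 D_mult by (intro exI[of _ "int n - 1"]) auto
    next
      case 2
      then show ?thesis using t n2 D_mult
        by (intro exI[of _ "1 - int n"]) (auto simp: algebra_simps abs_le_iff)
    next
      case 3
      define k where "k = round (t / D)"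
      have r: "\<bar>of_int k - t / D\<bar> \<le> 1 / 2" unfolding k_def by (rule of_int_round_abs_le)
      have "of_int k * D - t = (of_int k - t / D) * D" using D_pos by (simp add: field_simps)
      then have "\<bar>t - of_int k * D\<bar> = \<bar>of_int k - t / D\<bar> * D"
        using D_pos by (metis abs_minus_commute abs_mult abs_of_pos)
      also have "\<dots> \<le> 1 / 2 * D" using r D_pos by (intro mult_right_mono) auto
      also have "\<dots> \<le> l" using large by simp
      finally have near: "\<bar>t - of_int k * D\<bar> \<le> l" .
      have "\<bar>t\<bar> < (real n - 1) * D" using 3 D_mult by simp
      then have "\<bar>t / D\<bar> < real n - 1" using D_pos by (simp add: abs_divide divide_less_eq)
      then have "\<bar>of_int k\<bar> < real n" using r by linarith
      then have "\<bar>k\<bar> < int n" by linarith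
      with near show ?thesis by blast
    qed
  qed
  then obtain k :: int where k: "\<bar>k\<bar> < int n" "\<bar>t - of_int k * D\<bar> \<le> l" by blast
  define s where "s = (t - of_int k * D) / l"
  have "real (nat k) - real (nat (- k)) = of_int k" by (cases "k \<ge> 0") auto
  then have "t = l * s + (real (nat k) - real (nat (- k))) * D"
    using l_pos by (simp add: s_def)
  moreover have "s \<in> {-1..1}"
  proof -
    have "\<bar>s\<bar> \<le> 1" using k(2) l_pos by (simp add: s_def abs_divide)
    then show ?thesis by auto
  qed
  moreover have "nat k < n" "nat (- k) < n" using k(1) by linarith+
  ultimately show ?thesis by blast
qed

text \<open>
  A point of \<open>[-1,1]\<close> at greatest distance from the compact set \<open>E - E\<close> is the image, under a
  contraction with ratio \<open>l\<close> that maps \<open>E - E\<close> into itself, of a point of \<open>[-1,1]\<close>. So the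
  greatest distance is at most \<open>l\<close> times itself, and it vanishes.
\<close>

lemma differences_cover:
  assumes large: "D \<le> 2 * l" and t: "t \<in> {-1..1}"
  shows "\<exists>x\<in>E. \<exists>y\<in>E. t = x - y"
proof -
  define M where "M = {x - y | x y. x \<in> E \<and> y \<in> E}"
  have cM: "compact M" unfolding M_def by (rule compact_differences[OF E_compact E_compact])
  have neM: "M \<noteq> {}" unfolding M_def using E_nonempty by blast
  have "continuous_on {-1..1} (\<lambda>x. infdist x M)" by (intro continuous_intros)
  then obtain w where w: "w \<in> {-1..1}" "\<And>s. s \<in> {-1..1} \<Longrightarrow> infdist s M \<le> infdist w M"
    using continuous_attains_sup[of "{-1..1::real}" "\<lambda>x. infdist x M"] by auto
  obtain i j s where ijs: "i < n" "j < n" "s \<in> {-1..1}" "w = l * s + (real i - real j) * D"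
    using difference_intervals_cover[OF large w(1)] by blast
  obtain z where z: "z \<in> M" "infdist s M = dist s z"
    using infdist_attains_inf[OF compact_imp_closed[OF cM] neM] by metis
  obtain x y where xy: "x \<in> E" "y \<in> E" "z = x - y" using z(1) unfolding M_def by blast
  have "l * x + real i * D \<in> E" "l * y + real j * D \<in> E" using E_iff xy ijs by blast+
  moreover have "l * z + (real i - real j) * D
      = (l * x + real i * D) - (l * y + real j * D)"
    unfolding xy(3) by (simp add: algebra_simps)
  ultimately have "l * z + (real i - real j) * D \<in> M" unfolding M_def by blast
  then have "infdist w M \<le> dist w (l * z + (real i - real j) * D)" by (rule infdist_le)
  also have "\<dots> = l * dist s z"
    using l_pos ijs(4) by (simp add: dist_real_def abs_mult flip: right_diff_distrib)
  also have "\<dots> \<le> l * infdist w M" using z(2) w(2)[OF ijs(3)] l_pos by simp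
  finally have "(1 - l) * infdist w M \<le> 0" by (simp add: algebra_simps)
  then have "infdist w M \<le> 0" using l_less_1 by (simp add: mult_le_0_iff)
  then have "infdist t M = 0" using w(2)[OF t] infdist_nonneg[of t M] by linarith
  then have "t \<in> M" using in_closed_iff_infdist_zero[OF compact_imp_closed[OF cM] neM] by blast
  then show ?thesis unfolding M_def by blast
qed

lemma AP_length_double:
  assumes large: "D \<le> 2 * l"
  shows "\<exists>a \<delta>. \<delta> > 0 \<and> (\<forall>j<2 * n. a + real j * \<delta> \<in> E)"
proof -
  have "D / (2 * l) \<in> {-1..1}"
  proof -
    have "0 \<le> D / (2 * l)" using D_pos l_pos by simp
    moreover have "D / (2 * l) \<le> 1" using large l_pos by simp
    ultimately show ?thesis by simp
  qed
  then obtain x y where xy: "x \<in> E" "y \<in> E" "D / (2 * l) = x - y"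
    using differences_cover[OF large] by blast
  have half: "l * x = l * y + D / 2" using xy(3) l_pos by (simp add: field_simps)
  have "l * y + real j * (D / 2) \<in> E" if j: "j < 2 * n" for j
  proof -
    have d: "j div 2 < n" using j by auto
    show ?thesis
    proof (cases "even j")
      case True
      then have "real j = 2 * real (j div 2)"
        by (metis even_two_times_div_two of_nat_mult of_nat_numeral)
      then have "l * y + real j * (D / 2) = l * y + real (j div 2) * D" by simp
      then show ?thesis using E_iff d xy(2) by blast
    next
      case False
      then have "real j = 2 * real (j div 2) + 1"
        by (metis odd_two_times_div_two_succ of_nat_1 of_nat_add of_nat_mult of_nat_numeral)
      then have "l * y + real j * (D / 2) = l * x + real (j div 2) * D"
        using half by (simp add: algebra_simps)
      then show ?thesis using E_iff d xy(1) by blast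
    qed
  qed
  then show ?thesis using D_pos by (intro exI[of _ "l * y"] exI[of _ "D / 2"]) auto
qed

section \<open>The threshold\<close>

lemma AP_length_n: "enat n \<le> L_AP E"
proof -
  obtain x where x: "x \<in> E" using E_nonempty by blast
  have "\<forall>j<n. l * x + real j * D \<in> E" using E_iff x by blast
  then show ?thesis using n2 D_pos by (subst L_AP_ge_iff) auto
qed

lemma L_AP_ge_Suc_n: "enat (n + 1) \<le> L_AP E \<Longrightarrow> D \<le> 2 * l"
proof -
  assume "enat (n + 1) \<le> L_AP E"
  then obtain a \<delta> where "\<delta> > 0" "\<forall>j<n + 1. a + real j * \<delta> \<in> E"
    using L_AP_ge_iff[of "n + 1"] by auto
  then show "D \<le> 2 * l" using no_longer_AP[of \<delta> a] by force
qed

lemma L_AP_ge_double: "D \<le> 2 * l \<Longrightarrow> enat (2 * n) \<le> L_AP E"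
  using AP_length_double n2 by (subst L_AP_ge_iff) auto

end

theorem theorem1p4:
  fixes n :: nat and l :: real
  assumes "n \<ge> 2" and "l \<in> {0<..<1 / real n}"
  shows "(L_AP (homog_set n l) \<ge> enat (n + 1) \<longleftrightarrow> l \<ge> 1 / (2 * real n - 1))
       \<and> (l \<ge> 1 / (2 * real n - 1) \<longleftrightarrow> L_AP (homog_set n l) \<ge> enat (2 * n))
       \<and> (L_AP (homog_set n l) = enat n \<longleftrightarrow> l \<in> {0<..<1 / (2 * real n - 1)})"
proof -
  interpret homogeneous_system n l using assms by unfold_locales auto
  have "enat (n + 1) \<le> enat (2 * n)" using assms(1) by simp
  then have 31: "enat (2 * n) \<le> L_AP E \<Longrightarrow> enat (n + 1) \<le> L_AP E" by (rule order_trans)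
  have 12: "enat (n + 1) \<le> L_AP E \<longleftrightarrow> 1 / (2 * real n - 1) \<le> l"
    and 23: "1 / (2 * real n - 1) \<le> l \<longleftrightarrow> enat (2 * n) \<le> L_AP E"
    using L_AP_ge_Suc_n L_AP_ge_double 31 unfolding threshold_iff by blast+
  have "L_AP E = enat n \<longleftrightarrow> \<not> enat (n + 1) \<le> L_AP E"
    using AP_length_n by (cases "L_AP E") auto
  then have "L_AP E = enat n \<longleftrightarrow> l \<in> {0<..<1 / (2 * real n - 1)}"
    using 12 l_pos by auto
  with 12 23 show ?thesis by blast
qed

end
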